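(* Let $\mathbb{E}$ be a constructor space, let $F$ be an $\mathbb{E}$-form, and let $\mathrm{SynCat}[\mathbb{E},F]$ be its syntactic category. Let $$\mathit{hyp}\xrightarrow{\ \mathit{hypcon}\ }\mathit{wksp}\xleftarrow{\ \mathit{claimcon}\ }\mathit{claim}$$ be a potential factorization in $\mathrm{SynCat}[\mathbb{E},F]$. Then this potential factorization is deducible if and only if it is valid.
   Context: **Finite-limit sketches.** A graph is a directed multigraph with loops allowed. A finite-limit sketch $S$ consists of a graph, a set of finite (distinguished) diagrams in the graph, and a set of (distinguished) cones in the graph, each to a finite diagram in the graph. A model of $S$ in a category $\mathcal{C}$ is a graph homomorphism from the graph of $S$ to the underlying graph of $\mathcal{C}$ taking the distinguished diagrams to commutative diagrams and the distinguished cones to limit cones. A morphism of sketches is a graph homomorphism taking distinguished diagrams to distinguished diagrams and distinguished cones to distinguished cones. **Finite-limit theory.** $\mathrm{FinLimTh}[S]$ is the (small) category with finite limits equipped with a universal model of $S$: every model $M$ of $S$ in $\mathbf{Set}$ factors through the universal model by a finite-limit-preserving functor $\mathrm{FinLimTh}[S]\to\mathbf{Set}$, unique up to natural isomorphism. A sketch morphism $\eta$ induces a finite-limit-preserving functor $\mathrm{FinLimTh}[\eta]$. A specific instance of $\mathrm{FinLimTh}[S]$ is fixed, having specified finite limits such that the image of each distinguished cone of $S$ is a specified limit cone, and such that all its objects and arrows are obtained from $S$ by repeated application of the following *rules of construction*: - each node of $S$ gives an object, and each arrow of $S$ gives an arrow; - composable arrows $f,g$ give the composite $g\circ f$; - each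 object $c$ gives the identity arrow $\mathrm{Id}[c]$; - each finite diagram gives a specified limit cone (vertex and projections); - each commutative cone over a finite diagram $\delta$ gives the unique fill-in arrow from its vertex to the specified limit $\mathrm{Lim}[\delta]$. **Constructor spaces.** Fix a finite-limit sketch $\mathit{Cat}$ whose category of models in $\mathbf{Set}$ is the category of small categories and functors. A constructor space sketch is a finite-limit sketch $\mathcal{E}$ with a sketch morphism $\eta:\mathit{Cat}\to\mathcal{E}$ such that every object of $\mathrm{FinLimTh}[\mathcal{E}]$ is the limit of a finite diagram whose nodes are of the form $\mathrm{FinLimTh}[\eta](n)$ with $n$ a node of $\mathit{Cat}$. A constructor space is a category $\mathbb{E}=\mathrm{FinLimTh}[\mathcal{E}]$ for a constructor space sketch $\mathcal{E}$. **Forms and syntactic categories.** Let $\delta$ be a finite diagram in the graph of $\mathcal{E}$, and freely adjoin to $\mathbb{E}$ a global element $\phi:1\to\mathrm{Lim}[\delta]$, obtaining a category with finite limits $\mathbb{E}[\phi]$. The $\mathbb{E}$-form $F$ determined by $\delta$ is the value of $\phi$ in the initial model of $\mathbb{E}[\phi]$ in $\mathbf{Set}$. The category $\mathbb{E}[\phi]$ is called the syntactic category of $F$ and denoted $\mathrm{SynCat}[\mathbb{E},F]$. It is constructed as $\mathrm{FinLimTh}[S]$, where $S$ is the finite-limit sketch obtained from $\mathcal{E}$ by adjoining the arrow $\phi:1\to\mathrm{Lim}[\delta]$ (and, if not already present, nodes $1$ and $\mathrm{Lim}[\delta]$ with the distinguished cones making them a terminal object and a limit of $\delta$). A *model* of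 $\mathrm{SynCat}[\mathbb{E},F]$ is a finite-limit-preserving functor $\mathrm{SynCat}[\mathbb{E},F]\to\mathbf{Set}$. **Potential factorizations.** A potential factorization is a pair of arrows $\mathit{hypcon}:\mathit{hyp}\to\mathit{wksp}$, $\mathit{claimcon}:\mathit{claim}\to\mathit{wksp}$ of $\mathrm{SynCat}[\mathbb{E},F]$ with common codomain. - It is *deducible* if an arrow $\mathit{verif}:\mathit{hyp}\to\mathit{claim}$ of $\mathrm{SynCat}[\mathbb{E},F]$ can be constructed by the rules of construction such that $\mathit{claimcon}\circ\mathit{verif}=\mathit{hypcon}$. - A model $M$ *satisfies* it if there is a function $\xi:M(\mathit{hyp})\to M(\mathit{claim})$ with $M(\mathit{claimcon})\circ\xi=M(\mathit{hypcon})$. - It is *valid* if every model of $\mathrm{SynCat}[\mathbb{E},F]$ satisfies it. *)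

theory Defs
  imports Main "HOL-Library.FuncSet"
begin

section \<open>Graphs and categories\<close>

record ('n, 'e) graph =
  nodes :: "'n set"
  arrows :: "'e set"
  src :: "'e \<Rightarrow> 'n"
  tgt :: "'e \<Rightarrow> 'n"

definition is_graph :: "('n, 'e, 'z) graph_scheme \<Rightarrow> bool" where
  "is_graph G \<longleftrightarrow> (\<forall>a\<in>arrows G. src G a \<in> nodes G \<and> tgt G a \<in> nodes G)"

text \<open>A category is a graph with further structure, so it serves directly as its own underlying
  graph.  \<open>comp C g f\<close> is the composite "g after f"; it is meaningful only for
  \<open>src C g = tgt C f\<close>.\<close>

record ('n, 'e) category = "('n, 'e) graph" +
  ident :: "'n \<Rightarrow> 'e"
  comp :: "'e \<Rightarrow> 'e \<Rightarrow> 'e"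

definition arrow_from_to :: "('n, 'e, 'z) graph_scheme \<Rightarrow> 'e \<Rightarrow> 'n \<Rightarrow> 'n \<Rightarrow> bool" where
  "arrow_from_to G a x y \<longleftrightarrow> a \<in> arrows G \<and> src G a = x \<and> tgt G a = y"

definition is_category :: "('n, 'e, 'z) category_scheme \<Rightarrow> bool" where
  "is_category C \<longleftrightarrow>
     is_graph C \<and>
     (\<forall>x\<in>nodes C. arrow_from_to C (ident C x) x x) \<and>
     (\<forall>f\<in>arrows C. \<forall>g\<in>arrows C. src C g = tgt C f \<longrightarrow>
        arrow_from_to C (comp C g f) (src C f) (tgt C g)) \<and>
     (\<forall>f\<in>arrows C. comp C f (ident C (src C f)) = f \<and> comp C (ident C (tgt C f)) f = f) \<and>
     (\<forall>f\<in>arrows C. \<forall>g\<in>arrows C. \<forall>h\<in>arrows C. src C g = tgt C f \<longrightarrow> src C h = tgt C g \<longrightarrow>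
        comp C h (comp C g f) = comp C (comp C h g) f)"

definition is_iso :: "('n, 'e, 'z) category_scheme \<Rightarrow> 'e \<Rightarrow> bool" where
  "is_iso C f \<longleftrightarrow> f \<in> arrows C \<and>
     (\<exists>g. arrow_from_to C g (tgt C f) (src C f) \<and>
          comp C g f = ident C (src C f) \<and> comp C f g = ident C (tgt C f))"

text \<open>Graph homomorphisms are taken to be \<open>undefined\<close> outside the nodes and arrows of their domain,
  so that HOL equality is equality of homomorphisms.\<close>

record ('n, 'e, 'm, 'k) ghom =
  onN :: "'n \<Rightarrow> 'm"
  onA :: "'e \<Rightarrow> 'k"

definition graph_hom ::
  "('n, 'e, 'z) graph_scheme \<Rightarrow> ('m, 'k, 'y) graph_scheme \<Rightarrow> ('n, 'e, 'm, 'k) ghom \<Rightarrow> bool" where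
  "graph_hom G H h \<longleftrightarrow>
     onN h \<in> nodes G \<rightarrow>\<^sub>E nodes H \<and> onA h \<in> arrows G \<rightarrow>\<^sub>E arrows H \<and>
     (\<forall>a\<in>arrows G. src H (onA h a) = onN h (src G a) \<and> tgt H (onA h a) = onN h (tgt G a))"

definition ghom_id :: "('n, 'e, 'z) graph_scheme \<Rightarrow> ('n, 'e, 'n, 'e) ghom" where
  "ghom_id G = \<lparr>onN = (\<lambda>x\<in>nodes G. x), onA = (\<lambda>a\<in>arrows G. a)\<rparr>"

definition ghom_comp ::
  "('n, 'e, 'z) graph_scheme \<Rightarrow> ('m, 'k, 'p, 'q) ghom \<Rightarrow> ('n, 'e, 'm, 'k) ghom
     \<Rightarrow> ('n, 'e, 'p, 'q) ghom" where
  "ghom_comp G k h = \<lparr>onN = compose (nodes G) (onN k) (onN h),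
                      onA = compose (arrows G) (onA k) (onA h)\<rparr>"

definition is_functor ::
  "('n, 'e, 'z) category_scheme \<Rightarrow> ('m, 'k, 'y) category_scheme \<Rightarrow> ('n, 'e, 'm, 'k) ghom \<Rightarrow> bool" where
  "is_functor C D F \<longleftrightarrow>
     graph_hom C D F \<and>
     (\<forall>x\<in>nodes C. onA F (ident C x) = ident D (onN F x)) \<and>
     (\<forall>f\<in>arrows C. \<forall>g\<in>arrows C. src C g = tgt C f \<longrightarrow>
        onA F (comp C g f) = comp D (onA F g) (onA F f))"

text \<open>The domain need only be a graph: this gives natural transformations between functors as well
  as homomorphisms between models of a sketch.\<close>

definition nat_trans ::
  "('n, 'e, 'z) graph_scheme \<Rightarrow> ('m, 'k, 'y) category_scheme \<Rightarrow>
   ('n, 'e, 'm, 'k) ghom \<Rightarrow> ('n, 'e, 'm, 'k) ghom \<Rightarrow> ('n \<Rightarrow> 'k) \<Rightarrow> bool" where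
  "nat_trans G D F H \<alpha> \<longleftrightarrow>
     \<alpha> \<in> extensional (nodes G) \<and>
     (\<forall>x\<in>nodes G. arrow_from_to D (\<alpha> x) (onN F x) (onN H x)) \<and>
     (\<forall>a\<in>arrows G. comp D (onA H a) (\<alpha> (src G a)) = comp D (\<alpha> (tgt G a)) (onA F a))"

definition naturally_isomorphic ::
  "('n, 'e, 'z) graph_scheme \<Rightarrow> ('m, 'k, 'y) category_scheme \<Rightarrow>
   ('n, 'e, 'm, 'k) ghom \<Rightarrow> ('n, 'e, 'm, 'k) ghom \<Rightarrow> bool" where
  "naturally_isomorphic G D F H \<longleftrightarrow>
     (\<exists>\<alpha>. nat_trans G D F H \<alpha> \<and> (\<forall>x\<in>nodes G. is_iso D (\<alpha> x)))"

definition equivalent_categories ::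
  "('n, 'e, 'z) category_scheme \<Rightarrow> ('m, 'k, 'y) category_scheme \<Rightarrow> bool" where
  "equivalent_categories C D \<longleftrightarrow>
     (\<exists>F G. is_functor C D F \<and> is_functor D C G \<and>
        naturally_isomorphic C C (ghom_comp C G F) (ghom_id C) \<and>
        naturally_isomorphic D D (ghom_comp D F G) (ghom_id D))"


section \<open>Finite diagrams, cones and limits\<close>

text \<open>A finite diagram is a graph homomorphism from a finite graph, whose nodes and arrows are
  numbered: the shape has nodes \<open>{..<length (dnodes d)}\<close>, node \<open>i\<close> being sent to \<open>dnodes d ! i\<close>,
  and its \<open>m\<close>-th arrow runs from \<open>i\<close> to \<open>j\<close> and is sent to \<open>a\<close>, where
  \<open>dedges d ! m = (i, a, j)\<close>.\<close>

record ('n, 'e) diagram =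
  dnodes :: "'n list"
  dedges :: "(nat \<times> 'e \<times> nat) list"

record ('n, 'e) cone =
  vertex :: 'n
  legs :: "'e list"
  base :: "('n, 'e) diagram"

definition empty_diagram :: "('n, 'e) diagram" where
  "empty_diagram = \<lparr>dnodes = [], dedges = []\<rparr>"

definition diagram_in :: "('n, 'e, 'z) graph_scheme \<Rightarrow> ('n, 'e) diagram \<Rightarrow> bool" where
  "diagram_in G d \<longleftrightarrow>
     set (dnodes d) \<subseteq> nodes G \<and>
     (\<forall>(i, a, j) \<in> set (dedges d). i < length (dnodes d) \<and> j < length (dnodes d) \<and>
        arrow_from_to G a (dnodes d ! i) (dnodes d ! j))"

definition cone_in :: "('n, 'e, 'z) graph_scheme \<Rightarrow> ('n, 'e) cone \<Rightarrow> bool" where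
  "cone_in G c \<longleftrightarrow>
     diagram_in G (base c) \<and> vertex c \<in> nodes G \<and> length (legs c) = length (dnodes (base c)) \<and>
     (\<forall>i < length (legs c). arrow_from_to G (legs c ! i) (vertex c) (dnodes (base c) ! i))"

definition map_diagram :: "('n, 'e, 'm, 'k) ghom \<Rightarrow> ('n, 'e) diagram \<Rightarrow> ('m, 'k) diagram" where
  "map_diagram h d = \<lparr>dnodes = map (onN h) (dnodes d),
                      dedges = map (\<lambda>(i, a, j). (i, onA h a, j)) (dedges d)\<rparr>"

definition map_cone :: "('n, 'e, 'm, 'k) ghom \<Rightarrow> ('n, 'e) cone \<Rightarrow> ('m, 'k) cone" where
  "map_cone h c = \<lparr>vertex = onN h (vertex c), legs = map (onA h) (legs c),
                   base = map_diagram h (base c)\<rparr>"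

text \<open>\<open>path_composite C d i j f\<close>: some path from \<open>i\<close> to \<open>j\<close> in the shape of \<open>d\<close>, possibly of
  length 0, has composite \<open>f\<close> in \<open>C\<close>.\<close>

inductive path_composite ::
  "('n, 'e, 'z) category_scheme \<Rightarrow> ('n, 'e) diagram \<Rightarrow> nat \<Rightarrow> nat \<Rightarrow> 'e \<Rightarrow> bool"
  for C d where
  nil: "i < length (dnodes d) \<Longrightarrow> path_composite C d i i (ident C (dnodes d ! i))"
| snoc: "path_composite C d i j f \<Longrightarrow> (j, a, k) \<in> set (dedges d) \<Longrightarrow>
         path_composite C d i k (comp C a f)"

definition commutative_diagram :: "('n, 'e, 'z) category_scheme \<Rightarrow> ('n, 'e) diagram \<Rightarrow> bool" where
  "commutative_diagram C d \<longleftrightarrow>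
     diagram_in C d \<and>
     (\<forall>i j f g. path_composite C d i j f \<longrightarrow> path_composite C d i j g \<longrightarrow> f = g)"

definition commutative_cone :: "('n, 'e, 'z) category_scheme \<Rightarrow> ('n, 'e) cone \<Rightarrow> bool" where
  "commutative_cone C c \<longleftrightarrow>
     cone_in C c \<and>
     (\<forall>(i, a, j) \<in> set (dedges (base c)). comp C a (legs c ! i) = legs c ! j)"

definition fill_in ::
  "('n, 'e, 'z) category_scheme \<Rightarrow> ('n, 'e) cone \<Rightarrow> ('n, 'e) cone \<Rightarrow> 'e \<Rightarrow> bool" where
  "fill_in C k c f \<longleftrightarrow>
     arrow_from_to C f (vertex k) (vertex c) \<and>
     (\<forall>i < length (legs c). comp C (legs c ! i) f = legs k ! i)"

definition limit_cone :: "('n, 'e, 'z) category_scheme \<Rightarrow> ('n, 'e) cone \<Rightarrow> bool" where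
  "limit_cone C c \<longleftrightarrow>
     commutative_cone C c \<and>
     (\<forall>k. commutative_cone C k \<longrightarrow> base k = base c \<longrightarrow> (\<exists>!f. fill_in C k c f))"

definition lex_functor ::
  "('n, 'e, 'z) category_scheme \<Rightarrow> ('m, 'k, 'y) category_scheme \<Rightarrow> ('n, 'e, 'm, 'k) ghom \<Rightarrow> bool" where
  "lex_functor C D F \<longleftrightarrow>
     is_functor C D F \<and> (\<forall>c. limit_cone C c \<longrightarrow> limit_cone D (map_cone F c))"


section \<open>Sets and small categories\<close>

text \<open>The elements of the type \<open>'u\<close> play the role of a universe: a small set is a subset of
  \<open>'u\<close>, and a small category is a category whose objects and arrows are elements of \<open>'u\<close>.  When
  \<open>'u\<close> is infinite it contains a copy of \<open>'u \<times> 'u\<close>, so finite limits of small sets are again small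
  up to bijection, and they are the usual ones because one-element sets are small.  An arrow of the
  category of sets is a triple consisting of domain, function and codomain.\<close>

type_synonym 'u fn = "'u set \<times> ('u \<Rightarrow> 'u) \<times> 'u set"

definition Sets :: "('u set, 'u fn) category" where
  "Sets = \<lparr>nodes = UNIV,
           arrows = {(A, f, B). f \<in> A \<rightarrow>\<^sub>E B},
           src = (\<lambda>(A, f, B). A),
           tgt = (\<lambda>(A, f, B). B),
           ident = (\<lambda>A. (A, (\<lambda>x\<in>A. x), A)),
           comp = (\<lambda>(B', g, C) (A, f, B). (A, compose A g f, C))\<rparr>"

type_synonym 'u cat_functor =
  "('u, 'u) category \<times> ('u, 'u, 'u, 'u) ghom \<times> ('u, 'u) category"

definition SmallCats :: "(('u, 'u) category, 'u cat_functor) category" where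
  "SmallCats = \<lparr>nodes = {C. is_category C},
                arrows = {(C, F, D). is_category C \<and> is_category D \<and> is_functor C D F},
                src = (\<lambda>(C, F, D). C),
                tgt = (\<lambda>(C, F, D). D),
                ident = (\<lambda>C. (C, ghom_id C, C)),
                comp = (\<lambda>(D', G, E) (C, F, D). (C, ghom_comp C G F, E))\<rparr>"


section \<open>Finite-limit sketches and their models\<close>

record ('n, 'e) sketch = "('n, 'e) graph" +
  diagrams :: "('n, 'e) diagram set"
  cones :: "('n, 'e) cone set"

definition is_sketch :: "('n, 'e, 'z) sketch_scheme \<Rightarrow> bool" where
  "is_sketch S \<longleftrightarrow>
     is_graph S \<and> (\<forall>d\<in>diagrams S. diagram_in S d) \<and> (\<forall>c\<in>cones S. cone_in S c)"

definition is_model ::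
  "('n, 'e, 'z) sketch_scheme \<Rightarrow> ('m, 'k, 'y) category_scheme \<Rightarrow> ('n, 'e, 'm, 'k) ghom \<Rightarrow> bool" where
  "is_model S C M \<longleftrightarrow>
     graph_hom S C M \<and>
     (\<forall>d\<in>diagrams S. commutative_diagram C (map_diagram M d)) \<and>
     (\<forall>c\<in>cones S. limit_cone C (map_cone M c))"

definition sketch_morphism ::
  "('n, 'e, 'z) sketch_scheme \<Rightarrow> ('m, 'k, 'y) sketch_scheme \<Rightarrow> ('n, 'e, 'm, 'k) ghom \<Rightarrow> bool" where
  "sketch_morphism S S' h \<longleftrightarrow>
     graph_hom S S' h \<and>
     (\<forall>d\<in>diagrams S. map_diagram h d \<in> diagrams S') \<and>
     (\<forall>c\<in>cones S. map_cone h c \<in> cones S')"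

type_synonym ('n, 'e, 'u) set_model = "('n, 'e, 'u set, 'u fn) ghom"

definition Models ::
  "('n, 'e, 'z) sketch_scheme \<Rightarrow>
   (('n, 'e, 'u) set_model, ('n, 'e, 'u) set_model \<times> ('n \<Rightarrow> 'u fn) \<times> ('n, 'e, 'u) set_model) category"
  where
  "Models S = \<lparr>nodes = {M. is_model S Sets M},
               arrows = {(M, \<alpha>, N). is_model S Sets M \<and> is_model S Sets N \<and> nat_trans S Sets M N \<alpha>},
               src = (\<lambda>(M, \<alpha>, N). M),
               tgt = (\<lambda>(M, \<alpha>, N). N),
               ident = (\<lambda>M. (M, (\<lambda>x\<in>nodes S. ident Sets (onN M x)), M)),
               comp = (\<lambda>(N', \<beta>, P) (M, \<alpha>, N). (M, (\<lambda>x\<in>nodes S. comp Sets (\<beta> x) (\<alpha> x)), P))\<rparr>"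

definition sketch_for_categories :: "('u, 'u) sketch \<Rightarrow> bool" where
  "sketch_for_categories S \<longleftrightarrow>
     is_sketch S \<and>
     equivalent_categories
       (Models S :: (('u, 'u, 'u) set_model,
                     ('u, 'u, 'u) set_model \<times> ('u \<Rightarrow> 'u fn) \<times> ('u, 'u, 'u) set_model) category)
       (SmallCats :: (('u, 'u) category, 'u cat_functor) category)"


section \<open>Finite-limit theories\<close>

text \<open>The data of an instance of the finite-limit theory of a sketch: the category, the universal
  model, and the specified limit cones.  A finite diagram may have more than one specified limit
  cone: a sketch may have several distinguished cones over one diagram, and no instance in which
  each diagram has just one specified cone is then available in general.\<close>

record ('n, 'e, 'u) theory_data =
  th_cat :: "('u, 'u) category"
  th_univ :: "('n, 'e, 'u, 'u) ghom"
  th_spec :: "('u, 'u) cone set"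

definition has_specified_limits :: "('n, 'e, 'z) category_scheme \<Rightarrow> ('n, 'e) cone set \<Rightarrow> bool" where
  "has_specified_limits C L \<longleftrightarrow>
     (\<forall>c\<in>L. limit_cone C c) \<and> (\<forall>d. diagram_in C d \<longrightarrow> (\<exists>c\<in>L. base c = d))"

inductive
  constructible_obj :: "('n, 'e) sketch \<Rightarrow> ('n, 'e, 'u) theory_data \<Rightarrow> 'u \<Rightarrow> bool" and
  constructible_arr :: "('n, 'e) sketch \<Rightarrow> ('n, 'e, 'u) theory_data \<Rightarrow> 'u \<Rightarrow> bool"
  for S T where
  node: "n \<in> nodes S \<Longrightarrow> constructible_obj S T (onN (th_univ T) n)"
| arrow: "a \<in> arrows S \<Longrightarrow> constructible_arr S T (onA (th_univ T) a)"
| composite: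
    "constructible_arr S T f \<Longrightarrow> constructible_arr S T g \<Longrightarrow>
     f \<in> arrows (th_cat T) \<Longrightarrow> g \<in> arrows (th_cat T) \<Longrightarrow> src (th_cat T) g = tgt (th_cat T) f \<Longrightarrow>
     constructible_arr S T (comp (th_cat T) g f)"
| identity: "constructible_obj S T x \<Longrightarrow> constructible_arr S T (ident (th_cat T) x)"
| limit_vertex:
    "c \<in> th_spec T \<Longrightarrow>
     \<forall>x\<in>set (dnodes (base c)). constructible_obj S T x \<Longrightarrow>
     \<forall>e\<in>set (dedges (base c)). constructible_arr S T (fst (snd e)) \<Longrightarrow>
     constructible_obj S T (vertex c)"
| limit_leg:
    "c \<in> th_spec T \<Longrightarrow>
     \<forall>x\<in>set (dnodes (base c)). constructible_obj S T x \<Longrightarrow>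
     \<forall>e\<in>set (dedges (base c)). constructible_arr S T (fst (snd e)) \<Longrightarrow>
     p \<in> set (legs c) \<Longrightarrow>
     constructible_arr S T p"
| limit_fill_in:
    "c \<in> th_spec T \<Longrightarrow>
     \<forall>x\<in>set (dnodes (base c)). constructible_obj S T x \<Longrightarrow>
     \<forall>e\<in>set (dedges (base c)). constructible_arr S T (fst (snd e)) \<Longrightarrow>
     commutative_cone (th_cat T) k \<Longrightarrow> base k = base c \<Longrightarrow>
     constructible_obj S T (vertex k) \<Longrightarrow>
     \<forall>p\<in>set (legs k). constructible_arr S T p \<Longrightarrow>
     fill_in (th_cat T) k c f \<Longrightarrow>
     constructible_arr S T f"

definition is_FinLimTh :: "('n, 'e) sketch \<Rightarrow> ('n, 'e, 'u) theory_data \<Rightarrow> bool" where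
  "is_FinLimTh S T \<longleftrightarrow>
     is_category (th_cat T) \<and>
     has_specified_limits (th_cat T) (th_spec T) \<and>
     is_model S (th_cat T) (th_univ T) \<and>
     (\<forall>c\<in>cones S. map_cone (th_univ T) c \<in> th_spec T) \<and>
     (\<forall>M :: ('n, 'e, 'u) set_model. is_model S Sets M \<longrightarrow>
        (\<exists>F. lex_functor (th_cat T) Sets F \<and> ghom_comp S F (th_univ T) = M) \<and>
        (\<forall>F F'. lex_functor (th_cat T) Sets F \<and> ghom_comp S F (th_univ T) = M \<and>
                lex_functor (th_cat T) Sets F' \<and> ghom_comp S F' (th_univ T) = M \<longrightarrow>
                naturally_isomorphic (th_cat T) Sets F F')) \<and>
     (\<forall>x\<in>nodes (th_cat T). constructible_obj S T x) \<and>
     (\<forall>f\<in>arrows (th_cat T). constructible_arr S T f)"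

text \<open>\<open>K\<close> is the functor between the theories induced by the sketch morphism \<open>\<eta>\<close>.\<close>

definition is_FinLimTh_map ::
  "('n, 'e) sketch \<Rightarrow> ('n, 'e, 'm, 'k) ghom \<Rightarrow> ('n, 'e, 'u) theory_data \<Rightarrow> ('m, 'k, 'u) theory_data
     \<Rightarrow> ('u, 'u, 'u, 'u) ghom \<Rightarrow> bool" where
  "is_FinLimTh_map S \<eta> T T' K \<longleftrightarrow>
     lex_functor (th_cat T) (th_cat T') K \<and>
     ghom_comp S K (th_univ T) = ghom_comp S (th_univ T') \<eta>"


section \<open>Constructor spaces, forms and syntactic categories\<close>

definition constructor_space ::
  "('u, 'u) sketch \<Rightarrow> ('u, 'u, 'u) theory_data \<Rightarrow>
   ('u, 'u) sketch \<Rightarrow> ('u, 'u, 'u, 'u) ghom \<Rightarrow> ('u, 'u, 'u) theory_data \<Rightarrow> bool" where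
  "constructor_space Cat CatTh E \<eta> \<EE> \<longleftrightarrow>
     is_sketch E \<and> sketch_morphism Cat E \<eta> \<and> is_FinLimTh E \<EE> \<and>
     (\<exists>K. is_FinLimTh_map Cat \<eta> CatTh \<EE> K \<and>
        (\<forall>x\<in>nodes (th_cat \<EE>). \<exists>c. limit_cone (th_cat \<EE>) c \<and> vertex c = x \<and>
           (\<forall>y\<in>set (dnodes (base c)). \<exists>n\<in>nodes Cat. y = onN K (onN (th_univ CatTh) n))))"

datatype 'n form_node = Node 'n | NewOne | NewLim
datatype 'e form_arrow = Arrow 'e | NewProj nat | Phi

definition embed :: "('n, 'e, 'n form_node, 'e form_arrow) ghom" where
  "embed = \<lparr>onN = Node, onA = Arrow\<rparr>"

text \<open>The node representing the limit of \<open>d\<close>: the vertex of any distinguished cone over \<open>d\<close> if there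
  is one, and the node \<open>new\<close> otherwise.\<close>

definition limit_node ::
  "('n, 'e) sketch \<Rightarrow> ('n, 'e) diagram \<Rightarrow> 'n form_node \<Rightarrow> 'n form_node \<Rightarrow> bool" where
  "limit_node E d new v \<longleftrightarrow>
     (\<exists>c\<in>cones E. base c = d \<and> v = Node (vertex c)) \<or>
     (\<forall>c\<in>cones E. base c \<noteq> d) \<and> v = new"

definition extended_sketch ::
  "('n, 'e) sketch \<Rightarrow> ('n, 'e) diagram \<Rightarrow> 'n form_node \<Rightarrow> 'n form_node
     \<Rightarrow> ('n form_node, 'e form_arrow) sketch" where
  "extended_sketch E \<delta> one l =
     \<lparr>nodes = Node ` nodes E \<union> {one, l},
      arrows = Arrow ` arrows E \<union> {Phi} \<union>
               (if l = NewLim then NewProj ` {..<length (dnodes \<delta>)} else {}),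
      src = (\<lambda>a. case a of Arrow e \<Rightarrow> Node (src E e) | NewProj i \<Rightarrow> NewLim | Phi \<Rightarrow> one),
      tgt = (\<lambda>a. case a of Arrow e \<Rightarrow> Node (tgt E e) | NewProj i \<Rightarrow> Node (dnodes \<delta> ! i) | Phi \<Rightarrow> l),
      diagrams = map_diagram embed ` diagrams E,
      cones = map_cone embed ` cones E \<union>
              (if one = NewOne
               then {\<lparr>vertex = NewOne, legs = [], base = empty_diagram\<rparr>} else {}) \<union>
              (if l = NewLim
               then {\<lparr>vertex = NewLim, legs = map NewProj [0..<length (dnodes \<delta>)],
                      base = map_diagram embed \<delta>\<rparr>} else {})\<rparr>"

text \<open>If \<open>\<delta>\<close> is empty and has no distinguished cone, the new terminal node also serves as the limit
  of \<open>\<delta>\<close>.\<close>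

definition adjoins_global_element ::
  "('n, 'e) sketch \<Rightarrow> ('n, 'e) diagram \<Rightarrow> ('n form_node, 'e form_arrow) sketch \<Rightarrow> bool" where
  "adjoins_global_element E \<delta> S \<longleftrightarrow>
     (\<exists>one l. limit_node E empty_diagram NewOne one \<and>
              limit_node E \<delta> (if \<delta> = empty_diagram then one else NewLim) l \<and>
              S = extended_sketch E \<delta> one l)"

definition initial_model :: "('u, 'u) category \<Rightarrow> ('u, 'u, 'u) set_model \<Rightarrow> bool" where
  "initial_model C I \<longleftrightarrow>
     lex_functor C Sets I \<and>
     (\<forall>N. lex_functor C Sets N \<longrightarrow> (\<exists>!\<alpha>. nat_trans C Sets I N \<alpha>))"

text \<open>\<open>SynCat E \<delta> F S T\<close>: \<open>F\<close> is the form determined by \<open>\<delta>\<close>, and \<open>T\<close> is its syntactic category,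
  constructed as the finite-limit theory of the sketch \<open>S\<close>.\<close>

definition SynCat ::
  "('u, 'u) sketch \<Rightarrow> ('u, 'u) diagram \<Rightarrow> 'u fn \<Rightarrow> ('u form_node, 'u form_arrow) sketch
     \<Rightarrow> ('u form_node, 'u form_arrow, 'u) theory_data \<Rightarrow> bool" where
  "SynCat E \<delta> F S T \<longleftrightarrow>
     diagram_in E \<delta> \<and> adjoins_global_element E \<delta> S \<and> is_FinLimTh S T \<and>
     (\<exists>I. initial_model (th_cat T) I \<and> F = onA I (onA (th_univ T) Phi))"


section \<open>Potential factorizations\<close>

definition potential_factorization :: "('n, 'e, 'z) category_scheme \<Rightarrow> 'e \<Rightarrow> 'e \<Rightarrow> bool" where
  "potential_factorization C hypcon claimcon \<longleftrightarrow>
     hypcon \<in> arrows C \<and> claimcon \<in> arrows C \<and> tgt C hypcon = tgt C claimcon"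

definition deducible :: "('n, 'e) sketch \<Rightarrow> ('n, 'e, 'u) theory_data \<Rightarrow> 'u \<Rightarrow> 'u \<Rightarrow> bool" where
  "deducible S T hypcon claimcon \<longleftrightarrow>
     (\<exists>verif. constructible_arr S T verif \<and>
        arrow_from_to (th_cat T) verif (src (th_cat T) hypcon) (src (th_cat T) claimcon) \<and>
        comp (th_cat T) claimcon verif = hypcon)"

definition satisfies ::
  "('n, 'e, 'z) category_scheme \<Rightarrow> ('n, 'e, 'u) set_model \<Rightarrow> 'e \<Rightarrow> 'e \<Rightarrow> bool" where
  "satisfies C M hypcon claimcon \<longleftrightarrow>
     (\<exists>\<xi>. arrow_from_to Sets \<xi> (onN M (src C hypcon)) (onN M (src C claimcon)) \<and>
          comp Sets (onA M claimcon) \<xi> = onA M hypcon)"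

definition valid :: "('u, 'u) category \<Rightarrow> 'u \<Rightarrow> 'u \<Rightarrow> bool" where
  "valid C hypcon claimcon \<longleftrightarrow>
     (\<forall>M :: ('u, 'u, 'u) set_model. lex_functor C Sets M \<longrightarrow> satisfies C M hypcon claimcon)"

end

theory Submission
  imports Defs
begin

text \<open>The equivalence is the Yoneda lemma applied to one model.  A deduced factorization
  \<open>claimcon \<circ> verif = hypcon\<close> is an equation between composites, so every functor preserves it and
  \<open>M verif\<close> is the function that satisfaction in \<open>M\<close> asks for.

  Conversely, the representable functor \<open>Hom(hyp, -)\<close> preserves all limits
  (\<open>lex_functor_representable\<close>), and since the arrows of a small category are elements of the
  universe, its values are small sets.  It is therefore a model, and validity provides a
  function \<open>\<xi>\<close> from \<open>Hom(hyp, hyp)\<close> to \<open>Hom(hyp, claim)\<close> with \<open>claimcon \<circ> \<xi> g = hypcon \<circ> g\<close> for all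
  \<open>g\<close>.  The arrow \<open>\<xi> (Id[hyp])\<close> is a factorization of \<open>hypcon\<close> through \<open>claimcon\<close>.  It is
  constructible because every arrow of a finite-limit theory is.\<close>

section \<open>The category of small sets\<close>

lemma nodes_Sets: "nodes Sets = UNIV"
  by (simp add: Sets_def)

lemma arrow_from_to_Sets:
  "arrow_from_to Sets p A B \<longleftrightarrow> fst p = A \<and> snd (snd p) = B \<and> fst (snd p) \<in> A \<rightarrow>\<^sub>E B"
  by (cases p) (auto simp: arrow_from_to_def Sets_def)

lemma comp_Sets:
  "comp Sets q p = (fst p, compose (fst p) (fst (snd q)) (fst (snd p)), snd (snd q))"
  by (cases p; cases q) (auto simp: Sets_def)

lemma restrict_eq_extensional_iff:
  "w \<in> extensional A \<Longrightarrow> restrict u A = w \<longleftrightarrow> (\<forall>x\<in>A. u x = w x)"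
  by (auto intro: extensionalityI[OF restrict_extensional])

section \<open>Hom-sets and representable functors\<close>

definition hom_set :: "('n, 'e, 'z) category_scheme \<Rightarrow> 'n \<Rightarrow> 'n \<Rightarrow> 'e set" where
  "hom_set C x y = {f. arrow_from_to C f x y}"

definition representable :: "('n, 'u, 'z) category_scheme \<Rightarrow> 'n \<Rightarrow> ('n, 'u, 'u set, 'u fn) ghom" where
  "representable C h =
     \<lparr>onN = (\<lambda>x\<in>nodes C. hom_set C h x),
      onA = (\<lambda>f\<in>arrows C. (hom_set C h (src C f),
                          (\<lambda>g\<in>hom_set C h (src C f). comp C f g),
                          hom_set C h (tgt C f)))\<rparr>"

lemma
  assumes "is_category C"
  shows src_in_nodes: "f \<in> arrows C \<Longrightarrow> src C f \<in> nodes C"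
    and tgt_in_nodes: "f \<in> arrows C \<Longrightarrow> tgt C f \<in> nodes C"
  using assms by (auto simp: is_category_def is_graph_def)

lemma ident_in_hom_set: "is_category C \<Longrightarrow> x \<in> nodes C \<Longrightarrow> ident C x \<in> hom_set C x x"
  by (auto simp: is_category_def hom_set_def)

lemma comp_in_hom_set:
  assumes "is_category C" "f \<in> hom_set C x y" "g \<in> hom_set C y z"
  shows "comp C g f \<in> hom_set C x z"
  using assms by (auto simp: is_category_def hom_set_def arrow_from_to_def)

lemma comp_hom_set_assoc:
  assumes "is_category C" "f \<in> hom_set C w x" "g \<in> hom_set C x y" "k \<in> hom_set C y z"
  shows "comp C k (comp C g f) = comp C (comp C k g) f"
  using assms by (auto simp: is_category_def hom_set_def arrow_from_to_def)

lemma ident_comp: "is_category C \<Longrightarrow> f \<in> hom_set C x y \<Longrightarrow> comp C (ident C y) f = f"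
  by (auto simp: is_category_def hom_set_def arrow_from_to_def)

lemma comp_ident: "is_category C \<Longrightarrow> f \<in> hom_set C x y \<Longrightarrow> comp C f (ident C x) = f"
  by (auto simp: is_category_def hom_set_def arrow_from_to_def)

lemma onN_representable: "x \<in> nodes C \<Longrightarrow> onN (representable C h) x = hom_set C h x"
  by (simp add: representable_def)

lemma onA_representable:
  "f \<in> hom_set C x y \<Longrightarrow> onA (representable C h) f =
     (hom_set C h x, (\<lambda>g\<in>hom_set C h x. comp C f g), hom_set C h y)"
  by (auto simp: representable_def hom_set_def arrow_from_to_def)

lemma is_functor_representable:
  assumes C: "is_category C"
  shows "is_functor C Sets (representable C h)"
  unfolding is_functor_def
proof (intro conjI ballI impI)
  have "arrow_from_to Sets (onA (representable C h) f)
          (onN (representable C h) (src C f)) (onN (representable C h) (tgt C f))"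
    if f: "f \<in> arrows C" for f
  proof -
    have "f \<in> hom_set C (src C f) (tgt C f)"
      using f by (simp add: hom_set_def arrow_from_to_def)
    then show ?thesis
      using src_in_nodes[OF C f] tgt_in_nodes[OF C f]
      by (auto simp: onA_representable onN_representable arrow_from_to_Sets
          intro: comp_in_hom_set[OF C])
  qed
  moreover have "onN (representable C h) \<in> extensional (nodes C)"
    "onA (representable C h) \<in> extensional (arrows C)"
    by (simp_all add: representable_def)
  ultimately show "graph_hom C Sets (representable C h)"
    by (auto simp: graph_hom_def arrow_from_to_def PiE_def nodes_Sets)
next
  fix x assume x: "x \<in> nodes C"
  show "onA (representable C h) (ident C x) = ident Sets (onN (representable C h) x)"
    using x by (auto simp: onA_representable[OF ident_in_hom_set[OF C x]] onN_representable
        Sets_def ident_comp[OF C] intro!: restrict_ext)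
next
  fix f g assume f: "f \<in> arrows C" and g: "g \<in> arrows C" and gf: "src C g = tgt C f"
  have fh: "f \<in> hom_set C (src C f) (tgt C f)" and gh: "g \<in> hom_set C (tgt C f) (tgt C g)"
    using f g gf by (simp_all add: hom_set_def arrow_from_to_def)
  show "onA (representable C h) (comp C g f) =
        comp Sets (onA (representable C h) g) (onA (representable C h) f)"
    by (auto simp: onA_representable[OF fh] onA_representable[OF gh]
        onA_representable[OF comp_in_hom_set[OF C fh gh]] comp_Sets compose_def
        comp_hom_set_assoc[OF C _ fh gh] comp_in_hom_set[OF C _ fh] intro!: restrict_ext)
qed

section \<open>Representable functors preserve limits\<close>

lemma cone_leg_in_hom_set:
  assumes "cone_in C c" "i < length (dnodes (base c))"
  shows "legs c ! i \<in> hom_set C (vertex c) (dnodes (base c) ! i)"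
  using assms by (auto simp: cone_in_def hom_set_def)

lemma diagram_node: "diagram_in C d \<Longrightarrow> i < length (dnodes d) \<Longrightarrow> dnodes d ! i \<in> nodes C"
  by (auto simp: diagram_in_def)

lemma diagram_edge:
  assumes "diagram_in C d" "(i, a, j) \<in> set (dedges d)"
  shows "i < length (dnodes d)" "j < length (dnodes d)"
    "a \<in> hom_set C (dnodes d ! i) (dnodes d ! j)"
  using assms by (auto simp: diagram_in_def hom_set_def)

lemma functor_preserves_commutative_cone:
  assumes M: "is_functor C D M" and c: "commutative_cone C c"
  shows "commutative_cone D (map_cone M c)"
proof -
  have hom: "graph_hom C D M" using M by (simp add: is_functor_def)
  have arr: "arrow_from_to D (onA M a) (onN M x) (onN M y)" if "arrow_from_to C a x y" for a x y
    using hom that by (auto simp: graph_hom_def arrow_from_to_def)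
  have d: "diagram_in C (base c)" and cone: "cone_in C c"
    using c by (auto simp: commutative_cone_def cone_in_def)
  have "diagram_in D (map_diagram M (base c))"
    using d hom by (fastforce simp: diagram_in_def map_diagram_def graph_hom_def intro: arr)
  then have "cone_in D (map_cone M c)"
    using cone hom by (auto simp: cone_in_def map_cone_def map_diagram_def graph_hom_def intro: arr)
  moreover have "comp D (onA M a) (onA M (legs c ! i)) = onA M (legs c ! j)"
    if e: "(i, a, j) \<in> set (dedges (base c))" for i a j
  proof -
    have "comp C a (legs c ! i) = legs c ! j"
      using c e by (auto simp: commutative_cone_def)
    moreover have "onA M (comp C a (legs c ! i)) = comp D (onA M a) (onA M (legs c ! i))"
      using M diagram_edge[OF d e] cone_leg_in_hom_set[OF cone]
      by (auto simp: is_functor_def hom_set_def arrow_from_to_def)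
    ultimately show ?thesis by simp
  qed
  moreover have "i < length (legs c)" "j < length (legs c)"
    if e: "(i, a, j) \<in> set (dedges (base c))" for i a j
    using diagram_edge[OF d e] cone by (auto simp: cone_in_def)
  ultimately show ?thesis
    by (auto simp: commutative_cone_def map_cone_def map_diagram_def)
qed

text \<open>An element of the vertex of a cone over \<open>Hom(h, d)\<close> picks an arrow from \<open>h\<close> to each node of
  \<open>d\<close>, so cones of sets over \<open>Hom(h, d)\<close> are families of cones over \<open>d\<close> with vertex \<open>h\<close>.\<close>

lemma commutative_cone_of_element:
  assumes C: "is_category C" and h: "h \<in> nodes C" and d: "diagram_in C d"
    and k: "commutative_cone Sets k" "base k = map_diagram (representable C h) d"
    and x: "x \<in> vertex k"
  shows "commutative_cone C \<lparr>vertex = h, legs = map (\<lambda>p. fst (snd p) x) (legs k), base = d\<rparr>"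
proof -
  have len: "length (legs k) = length (dnodes d)"
    using k by (auto simp: commutative_cone_def cone_in_def map_diagram_def)
  have leg: "arrow_from_to Sets (legs k ! i) (vertex k) (hom_set C h (dnodes d ! i))"
    if "i < length (dnodes d)" for i
    using k that len diagram_node[OF d that]
    by (auto simp: commutative_cone_def cone_in_def map_diagram_def onN_representable)
  have element: "fst (snd (legs k ! i)) x \<in> hom_set C h (dnodes d ! i)"
    if "i < length (dnodes d)" for i
    using leg[OF that] x by (auto simp: arrow_from_to_Sets)
  have "comp C a (fst (snd (legs k ! i)) x) = fst (snd (legs k ! j)) x"
    if e: "(i, a, j) \<in> set (dedges d)" for i a j
  proof -
    note edge = diagram_edge[OF d e]
    have "comp Sets (onA (representable C h) a) (legs k ! i) = legs k ! j"
      using k e by (force simp: commutative_cone_def map_diagram_def)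
    then have "fst (snd (comp Sets (onA (representable C h) a) (legs k ! i))) x
               = fst (snd (legs k ! j)) x" by simp
    then show ?thesis
      using leg[OF edge(1)] element[OF edge(1)] x
      by (simp add: comp_Sets onA_representable[OF edge(3)] compose_def arrow_from_to_Sets)
  qed
  then show ?thesis
    using d h len element diagram_edge[OF d]
    by (fastforce simp: commutative_cone_def cone_in_def hom_set_def)
qed

text \<open>Applying the universal property of \<open>c\<close> to the cone of each element separately produces the
  fill-in function; its uniqueness is likewise checked element by element.\<close>

lemma representable_preserves_limit_cone:
  assumes C: "is_category C" and h: "h \<in> nodes C" and c: "limit_cone C c"
  shows "limit_cone Sets (map_cone (representable C h) c)"
  unfolding limit_cone_def
proof (intro conjI allI impI)
  let ?M = "representable C h"
  have cc: "commutative_cone C c" using c by (simp add: limit_cone_def)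
  then show "commutative_cone Sets (map_cone ?M c)"
    by (rule functor_preserves_commutative_cone[OF is_functor_representable[OF C]])
  fix k assume k: "commutative_cone Sets k" and "base k = base (map_cone ?M c)"
  then have bk: "base k = map_diagram ?M (base c)" by (simp add: map_cone_def)
  let ?point = "\<lambda>x. \<lparr>vertex = h, legs = map (\<lambda>p. fst (snd p) x) (legs k), base = base c\<rparr>"
  have d: "diagram_in C (base c)" and cone: "cone_in C c" and v: "vertex c \<in> nodes C"
    and lenc: "length (legs c) = length (dnodes (base c))"
    using cc by (auto simp: commutative_cone_def cone_in_def)
  have lenk: "length (legs k) = length (legs c)"
    using k bk lenc by (auto simp: commutative_cone_def cone_in_def map_diagram_def)
  have leg: "legs c ! i \<in> hom_set C (vertex c) (dnodes (base c) ! i)" if "i < length (legs c)" for i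
    using cone_leg_in_hom_set[OF cone] that lenc by simp
  have legk: "arrow_from_to Sets (legs k ! i) (vertex k) (hom_set C h (dnodes (base c) ! i))"
    if "i < length (legs c)" for i
    using k bk that lenk lenc diagram_node[OF d, of i]
    by (auto simp: commutative_cone_def cone_in_def map_diagram_def onN_representable)
  have unique: "\<exists>!f. fill_in C (?point x) c f" if "x \<in> vertex k" for x
    using c commutative_cone_of_element[OF C h d k bk that] by (simp add: limit_cone_def)
  \<comment> \<open>A fill-in of sets is a choice, for each element, of the fill-in for that element's cone.\<close>
  have fill_iff: "fill_in Sets k (map_cone ?M c) \<phi> \<longleftrightarrow>
      fst \<phi> = vertex k \<and> snd (snd \<phi>) = hom_set C h (vertex c) \<and>
      fst (snd \<phi>) \<in> extensional (vertex k) \<and>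
      (\<forall>x\<in>vertex k. fill_in C (?point x) c (fst (snd \<phi>) x))" (is "?L \<longleftrightarrow> ?R") for \<phi>
  proof -
    let ?g = "fst (snd \<phi>)"
    have "comp Sets (onA ?M (legs c ! i)) \<phi> = legs k ! i \<longleftrightarrow>
          (\<forall>x\<in>vertex k. comp C (legs c ! i) (?g x) = fst (snd (legs k ! i)) x)"
      if i: "i < length (legs c)" and dom: "fst \<phi> = vertex k"
        and g: "\<And>x. x \<in> vertex k \<Longrightarrow> ?g x \<in> hom_set C h (vertex c)" for i
    proof -
      have "comp Sets (onA ?M (legs c ! i)) \<phi> =
            (vertex k, (\<lambda>x\<in>vertex k. comp C (legs c ! i) (?g x)), hom_set C h (dnodes (base c) ! i))"
        using dom g
        by (auto simp: comp_Sets onA_representable[OF leg[OF i]] compose_def intro!: restrict_ext)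
      moreover define l where "l = fst (snd (legs k ! i))"
      have "legs k ! i = (vertex k, l, hom_set C h (dnodes (base c) ! i))"
        and "l \<in> extensional (vertex k)"
        using legk[OF i] by (cases "legs k ! i"; simp add: l_def arrow_from_to_Sets PiE_def)+
      ultimately show ?thesis by (simp add: restrict_eq_extensional_iff)
    qed
    note comp_iff = this
    show ?thesis
    proof
      assume ?L
      then have dom: "fst \<phi> = vertex k" "snd (snd \<phi>) = hom_set C h (vertex c)"
        and g: "?g \<in> vertex k \<rightarrow>\<^sub>E hom_set C h (vertex c)"
        and com: "\<And>i. i < length (legs c) \<Longrightarrow> comp Sets (onA ?M (legs c ! i)) \<phi> = legs k ! i"
        using v by (auto simp: fill_in_def map_cone_def arrow_from_to_Sets onN_representable)
      have "comp C (legs c ! i) (?g x) = fst (snd (legs k ! i)) x"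
        if "x \<in> vertex k" "i < length (legs c)" for x i
        using comp_iff[OF that(2) dom(1)] com[OF that(2)] that(1) g by blast
      then show ?R
        using dom g lenk by (auto simp: fill_in_def hom_set_def PiE_def)
    next
      assume R: ?R
      then have g: "\<And>x. x \<in> vertex k \<Longrightarrow> ?g x \<in> hom_set C h (vertex c)"
        by (auto simp: fill_in_def hom_set_def)
      have "comp Sets (onA ?M (legs c ! i)) \<phi> = legs k ! i" if "i < length (legs c)" for i
        using comp_iff[OF that] R g that lenk by (auto simp: fill_in_def)
      then show ?L
        using R g v by (auto simp: fill_in_def map_cone_def arrow_from_to_Sets onN_representable PiE_def)
    qed
  qed
  let ?\<phi> = "(vertex k, (\<lambda>x\<in>vertex k. THE f. fill_in C (?point x) c f), hom_set C h (vertex c))"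
  show "\<exists>!\<phi>. fill_in Sets k (map_cone ?M c) \<phi>"
  proof (rule ex1I[of _ ?\<phi>])
    show "fill_in Sets k (map_cone ?M c) ?\<phi>"
      by (simp add: fill_iff theI'[OF unique])
  next
    fix \<phi> assume "fill_in Sets k (map_cone ?M c) \<phi>"
    then show "\<phi> = ?\<phi>"
      by (cases \<phi>) (auto simp: fill_iff the1_equality[OF unique]
          intro!: extensionalityI[OF _ restrict_extensional])
  qed
qed

lemma lex_functor_representable:
  assumes "is_category C" and "h \<in> nodes C"
  shows "lex_functor C Sets (representable C h)"
  using assms
  by (simp add: lex_functor_def is_functor_representable representable_preserves_limit_cone)

section \<open>Factorizations and their satisfaction in models\<close>

lemma functor_satisfies_factorization:
  assumes M: "is_functor C Sets M" and claimcon: "claimcon \<in> arrows C"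
    and verif: "arrow_from_to C verif (src C hypcon) (src C claimcon)"
    and eq: "comp C claimcon verif = hypcon"
  shows "satisfies C M hypcon claimcon"
  unfolding satisfies_def
proof (intro exI conjI)
  show "arrow_from_to Sets (onA M verif) (onN M (src C hypcon)) (onN M (src C claimcon))"
    using M verif by (auto simp: is_functor_def graph_hom_def arrow_from_to_def)
  show "comp Sets (onA M claimcon) (onA M verif) = onA M hypcon"
    using M verif claimcon eq by (auto simp: is_functor_def arrow_from_to_def)
qed

text \<open>The identity is the generic element of \<open>Hom(hyp, hyp)\<close>: whatever \<open>\<xi>\<close> does to it is an arrow
  of the category, and the equation for \<open>\<xi>\<close> at the identity is the factorization.\<close>

lemma factorization_of_representable_satisfies:
  assumes C: "is_category C" and pf: "potential_factorization C hypcon claimcon"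
    and sat: "satisfies C (representable C (src C hypcon)) hypcon claimcon"
  obtains verif where "arrow_from_to C verif (src C hypcon) (src C claimcon)"
    and "comp C claimcon verif = hypcon"
proof -
  let ?h = "src C hypcon"
  have arrows: "hypcon \<in> arrows C" "claimcon \<in> arrows C"
    and hyp: "hypcon \<in> hom_set C ?h (tgt C hypcon)"
    and claim: "claimcon \<in> hom_set C (src C claimcon) (tgt C hypcon)"
    using pf by (auto simp: potential_factorization_def hom_set_def arrow_from_to_def)
  have id: "ident C ?h \<in> hom_set C ?h ?h"
    using ident_in_hom_set[OF C] src_in_nodes[OF C] arrows by simp
  obtain \<xi> where \<xi>: "fst \<xi> = hom_set C ?h ?h"
      "fst (snd \<xi>) \<in> hom_set C ?h ?h \<rightarrow>\<^sub>E hom_set C ?h (src C claimcon)"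
    and eq: "comp Sets (onA (representable C ?h) claimcon) \<xi> = onA (representable C ?h) hypcon"
    using sat src_in_nodes[OF C] arrows
    by (auto simp: satisfies_def arrow_from_to_Sets onN_representable)
  let ?verif = "fst (snd \<xi>) (ident C ?h)"
  have verif: "?verif \<in> hom_set C ?h (src C claimcon)" using \<xi>(2) id by auto
  have "fst (snd (comp Sets (onA (representable C ?h) claimcon) \<xi>)) (ident C ?h)
        = fst (snd (onA (representable C ?h) hypcon)) (ident C ?h)"
    using eq by simp
  then have "comp C claimcon ?verif = hypcon"
    using id verif \<xi>(1) comp_ident[OF C hyp]
    by (simp add: comp_Sets onA_representable[OF hyp] onA_representable[OF claim] compose_def)
  with verif show thesis by (auto simp: hom_set_def intro: that)
qed

lemma deducible_iff_valid:
  fixes T :: "('n, 'e, 'u) theory_data"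
  assumes T: "is_FinLimTh S T" and pf: "potential_factorization (th_cat T) hypcon claimcon"
  shows "deducible S T hypcon claimcon \<longleftrightarrow> valid (th_cat T) hypcon claimcon"
proof
  have C: "is_category (th_cat T)" using T by (simp add: is_FinLimTh_def)
  have arrows: "hypcon \<in> arrows (th_cat T)" "claimcon \<in> arrows (th_cat T)"
    using pf by (auto simp: potential_factorization_def)
  show "valid (th_cat T) hypcon claimcon" if "deducible S T hypcon claimcon"
    using that arrows
    by (auto simp: deducible_def valid_def lex_functor_def intro: functor_satisfies_factorization)
  show "deducible S T hypcon claimcon" if "valid (th_cat T) hypcon claimcon"
  proof -
    have "satisfies (th_cat T) (representable (th_cat T) (src (th_cat T) hypcon)) hypcon claimcon"
      using that lex_functor_representable[OF C src_in_nodes[OF C arrows(1)]]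
      by (simp add: valid_def)
    then obtain verif
      where verif: "arrow_from_to (th_cat T) verif (src (th_cat T) hypcon) (src (th_cat T) claimcon)"
        and "comp (th_cat T) claimcon verif = hypcon"
      by (rule factorization_of_representable_satisfies[OF C pf])
    moreover have "constructible_arr S T verif"
      using T verif by (auto simp: is_FinLimTh_def arrow_from_to_def)
    ultimately show ?thesis by (auto simp: deducible_def)
  qed
qed

theorem theorem8p2p1:
  fixes Cat E :: "('u, 'u) sketch"
    and CatTh \<EE> :: "('u, 'u, 'u) theory_data"
    and \<eta> :: "('u, 'u, 'u, 'u) ghom"
    and \<delta> :: "('u, 'u) diagram"
    and F :: "'u fn"
    and S :: "('u form_node, 'u form_arrow) sketch"
    and T :: "('u form_node, 'u form_arrow, 'u) theory_data"
    and hypcon claimcon :: 'u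
  assumes "infinite (UNIV :: 'u set)"
    and "sketch_for_categories Cat"
    and "is_FinLimTh Cat CatTh"
    and "constructor_space Cat CatTh E \<eta> \<EE>"
    and "SynCat E \<delta> F S T"
    and "potential_factorization (th_cat T) hypcon claimcon"
  shows "deducible S T hypcon claimcon \<longleftrightarrow> valid (th_cat T) hypcon claimcon"
  using assms by (simp add: SynCat_def deducible_iff_valid)

end
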